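(* For every $n$ there is a carefully synchronizing PFA on $n$ states and three symbols with shortest carefully synchronizing word length $\Omega(\phi^{n/3})$, where $\phi = \frac{1+\sqrt5}{2}$. That is, there are a constant $c>0$ and an integer $N$ such that for every integer $n\ge N$ there is a carefully synchronizing PFA with exactly $n$ states and an alphabet of three symbols, all of whose carefully synchronizing words have length at least $c\,\phi^{n/3}$.
   Context: A partial finite automaton (PFA) over a finite alphabet $\Sigma$ consists of a finite set $Q$ of states and a partial map $\delta : Q\times\Sigma \to Q$. For $q\in Q$, $w\in\Sigma^*$, $a\in\Sigma$ define $q\lambda = q$ for the empty word $\lambda$, and $q(wa) = \delta(qw,a)$, which is defined only if $qw$ is defined and $\delta(qw,a)$ is defined. A word $w\in\Sigma^*$ is carefully synchronizing if there is a state $q_s\in Q$ such that $qw$ is defined and $qw = q_s$ for all $q \in Q$. A PFA is carefully synchronizing if it admits a carefully synchronizing word. *)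

theory Defs
  imports Complex_Main
begin

text \<open>Partial finite automata with explicit carriers. The transition function is a
  partial map defined only on pairs from \<open>Q \<times> \<Sigma>\<close> and with values in \<open>Q\<close>.\<close>

locale pfa =
  fixes Q :: "'q set" and \<Sigma> :: "'a set" and \<delta> :: "'q \<times> 'a \<rightharpoonup> 'q"
  assumes finite_states: "finite Q"
    and finite_alphabet: "finite \<Sigma>"
    and dom_delta: "dom \<delta> \<subseteq> Q \<times> \<Sigma>"
    and ran_delta: "ran \<delta> \<subseteq> Q"

text \<open>\<open>run \<delta> q w\<close> is the state \<open>qw\<close>; \<open>None\<close> means that \<open>qw\<close> is undefined.\<close>

definition run :: "('q \<times> 'a \<rightharpoonup> 'q) \<Rightarrow> 'q \<Rightarrow> 'a list \<Rightarrow> 'q option" where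
  "run \<delta> q w = foldl (\<lambda>p a. Option.bind p (\<lambda>p'. \<delta> (p', a))) (Some q) w"

lemma run_Nil [simp]: "run \<delta> q [] = Some q"
  by (simp add: run_def)

lemma run_snoc: "run \<delta> q (w @ [a]) = Option.bind (run \<delta> q w) (\<lambda>p. \<delta> (p, a))"
  by (simp add: run_def)

definition carefully_synchronizing_word ::
  "'q set \<Rightarrow> 'a set \<Rightarrow> ('q \<times> 'a \<rightharpoonup> 'q) \<Rightarrow> 'a list \<Rightarrow> bool" where
  "carefully_synchronizing_word Q \<Sigma> \<delta> w \<longleftrightarrow>
     w \<in> lists \<Sigma> \<and> (\<exists>q\<^sub>s\<in>Q. \<forall>q\<in>Q. run \<delta> q w = Some q\<^sub>s)"

definition carefully_synchronizing ::
  "'q set \<Rightarrow> 'a set \<Rightarrow> ('q \<times> 'a \<rightharpoonup> 'q) \<Rightarrow> bool" where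
  "carefully_synchronizing Q \<Sigma> \<delta> \<longleftrightarrow> (\<exists>w. carefully_synchronizing_word Q \<Sigma> \<delta> w)"

definition golden_ratio :: real where
  "golden_ratio = (1 + sqrt 5) / 2"

end

theory Submission
  imports Defs "HOL-Library.Countable"
begin

text \<open>
  A word acts on all states of a partial automaton at once, so it moves a set of tokens, one
  on each occupied state. The tokens cannot see each other, but a letter that is undefined for
  a single token is forbidden altogether. The letters are therefore a transcript of a
  computation that every token checks on its own. The automaton below makes this computation
  a binary counter on \<open>m\<close> bits, so that at least \<open>2 ^ m\<close> letters must be read
  before all tokens can meet in one state.

  The tokens form a ring of \<open>m + 1\<close> cells, \<open>m\<close> of them with a bit and one with a mark that
  separates the highest bit from the lowest, together with a control token. The letter
  \<open>Rotate\<close> turns the ring by one cell. Between two rotations the letter \<open>Tick\<close> is read a number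
  of times, counted both by the cell in head position and by the control token, and this
  number announces what happens to the head cell:

    \<^item> no tick: a bit is kept, in mode \<open>Copy\<close>;
    \<^item> one tick: the mark passes, and the mode turns from \<open>Copy\<close> to \<open>Carry\<close>;
    \<^item> two ticks: a bit falls from 1 to 0, and the mode stays \<open>Carry\<close>;
    \<^item> three ticks: a bit rises from 0 to 1, and the mode turns from \<open>Carry\<close> to \<open>Copy\<close>.

  The cell forbids an announcement that does not fit its content, the control token one that
  does not fit its mode. What remains is the successor function of binary numbers, one
  increment per turn of the ring. If the mark passes in mode \<open>Carry\<close>, the counter has
  overflowed, and only then is the control token sent to a state \<open>Final\<close> where everything is
  allowed. The other tokens can then be thrown into \<open>Final\<close> one by one, by reading four ticks.
  The third letter, \<open>Reset\<close>, is the only one that is defined everywhere. It must come first,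
  and whenever it is read it sets the counter to 0. It sends the token in position \<open>j\<close> to the
  initial content of position \<open>j\<close>; as every position is always occupied, this restores the
  whole ring even if it was turned.

  Each bit costs three states, one for each possible content of an additional position, so
  \<open>n\<close> states give about \<open>n / 3\<close> bits. The lower bound \<open>2 ^ m\<close> is thus of order
  \<open>2 powr (n / 3)\<close>, which dominates the claimed rate because the golden ratio is below 2.

  The lower bound is \<open>synchronizing_word_long\<close>: the tokens form a configuration of the counter
  whose \<open>weight\<close> grows by at most one per letter (\<open>defined_config_step\<close>), whereas overflow
  needs weight \<open>2 ^ m\<close>. Existence of a synchronizing word is \<open>counter_synchronizing\<close>.
\<close>

section \<open>Words acting on sets of states\<close>

text \<open>The equation of images says two things: the word is defined on all of \<open>S\<close>, as needed to
  exhibit synchronizing words, and every state of \<open>T\<close> is occupied afterwards, as needed to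
  rule out short ones.\<close>

definition maps_onto :: "('q \<times> 'a \<rightharpoonup> 'q) \<Rightarrow> 'q set \<Rightarrow> 'a list \<Rightarrow> 'q set \<Rightarrow> bool" where
  "maps_onto \<delta> S w T \<longleftrightarrow> (\<lambda>q. run \<delta> q w) ` S = Some ` T"

lemma run_append: "run \<delta> q (u @ v) = Option.bind (run \<delta> q u) (\<lambda>p. run \<delta> p v)"
proof (induction v rule: rev_induct)
  case (snoc a v)
  then show ?case
    by (simp add: run_snoc flip: append_assoc)
qed simp

lemma maps_onto_append:
  assumes "maps_onto \<delta> S u T" and "maps_onto \<delta> T v U"
  shows "maps_onto \<delta> S (u @ v) U"
proof -
  have "(\<lambda>q. run \<delta> q (u @ v)) ` S
      = (\<lambda>x. Option.bind x (\<lambda>p. run \<delta> p v)) ` (\<lambda>q. run \<delta> q u) ` S"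
    by (simp add: run_append image_image)
  also have "\<dots> = (\<lambda>p. run \<delta> p v) ` T"
    using assms(1) by (simp add: maps_onto_def image_image)
  finally show ?thesis
    using assms(2) by (simp add: maps_onto_def)
qed

lemma maps_onto_letter: "maps_onto \<delta> S [a] T \<longleftrightarrow> (\<lambda>q. \<delta> (q, a)) ` S = Some ` T"
  by (simp add: maps_onto_def run_def)

lemma maps_onto_Nil: "maps_onto \<delta> S [] S"
  by (simp add: maps_onto_def)

section \<open>The automaton\<close>

datatype letter = Reset | Tick | Rotate

datatype symbol = Bit bool | Mark

datatype mode = Copy | Carry

text \<open>\<open>Rest j s\<close> is a cell with content \<open>s\<close> in a position \<open>j \<ge> 1\<close>. Only the cell in head
  position 0 has to count ticks; a second parameter for the other positions would cost more
  than three states per bit. \<open>Pad\<close> states adjust the number of states to a given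
  residue modulo 3; since only \<open>Reset\<close> is defined there, they are left for good with the
  first letter.\<close>

datatype state = Rest nat symbol | Head symbol nat | Control mode nat | Final | Pad nat

definition place :: "nat \<Rightarrow> symbol \<Rightarrow> nat \<Rightarrow> state" where
  "place j s k = (if j = 0 then Head s k else Rest j s)"

text \<open>The content with which the head cell returns to the ring after \<open>k\<close> ticks. The numbers
  of ticks for keeping a bit, passing the mark, clearing a bit and setting a bit are distinct,
  so that cell and control cannot interpret the same word differently.\<close>

fun rewrite :: "symbol \<Rightarrow> nat \<Rightarrow> symbol option" where
  "rewrite (Bit b) k =
     (if k = 0 then Some (Bit b)
      else if k = (if b then 2 else 3) then Some (Bit (\<not> b)) else None)"
| "rewrite Mark k = (if k = 1 then Some Mark else None)"

text \<open>In mode \<open>Carry\<close> a single tick is compatible only with a mark in head position,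
  so \<open>Final\<close> is entered only when a carry leaves the highest bit.\<close>

fun next_control :: "mode \<Rightarrow> nat \<Rightarrow> state option" where
  "next_control Copy k =
     (if k = 0 then Some (Control Copy 0)
      else if k = 1 then Some (Control Carry 0) else None)"
| "next_control Carry k =
     (if k = 1 then Some Final
      else if k = 2 then Some (Control Carry 0)
      else if k = 3 then Some (Control Copy 0) else None)"

text \<open>A head cell falls into \<open>Final\<close> with the fourth tick, whatever its content. As
  long as the control token has not reached \<open>Final\<close> itself, it allows at most three ticks
  between rotations and thereby protects all cells.\<close>

fun transition :: "nat \<Rightarrow> state \<Rightarrow> letter \<Rightarrow> state option" where
  "transition m (Rest j s) Reset = Some (Rest j (Bit False))"
| "transition m (Head s k) Reset = Some (Head Mark 0)"
| "transition m _ Reset = Some (Control Copy 0)"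
| "transition m (Rest j s) Tick = Some (Rest j s)"
| "transition m (Rest j s) Rotate = Some (place (j - 1) s 0)"
| "transition m (Head s k) Tick = Some (if k < 3 then Head s (Suc k) else Final)"
| "transition m (Head s k) Rotate = map_option (Rest m) (rewrite s k)"
| "transition m (Control c k) Tick =
     (if k < (case c of Copy \<Rightarrow> 1 | Carry \<Rightarrow> 3) then Some (Control c (Suc k)) else None)"
| "transition m (Control c k) Rotate = next_control c k"
| "transition m Final _ = Some Final"
| "transition m (Pad i) _ = None"

definition states :: "nat \<Rightarrow> nat \<Rightarrow> state set" where
  "states m p = (\<lambda>(j, s). Rest j s) ` ({1..m} \<times> UNIV) \<union> (\<lambda>(s, k). Head s k) ` (UNIV \<times> {..3})
     \<union> (\<lambda>(c, k). Control c k) ` (UNIV \<times> {..3}) \<union> {Final} \<union> Pad ` {..<p}"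

definition counter :: "nat \<Rightarrow> nat \<Rightarrow> state \<times> letter \<rightharpoonup> state" where
  "counter m p = (\<lambda>(q, a). if q \<in> states m p then transition m q a else None)"

lemma mem_states [simp]:
  "Rest j s \<in> states m p \<longleftrightarrow> 1 \<le> j \<and> j \<le> m"
  "Head s k \<in> states m p \<longleftrightarrow> k \<le> 3"
  "Control c k \<in> states m p \<longleftrightarrow> k \<le> 3"
  "Final \<in> states m p"
  "Pad i \<in> states m p \<longleftrightarrow> i < p"
  by (auto simp: states_def)

lemma UNIV_symbol: "UNIV = {Bit False, Bit True, Mark}"
proof -
  have "s \<in> {Bit False, Bit True, Mark}" for s
    by (cases s) auto
  then show ?thesis by blast
qed

lemma UNIV_mode: "UNIV = {Copy, Carry}"
  using mode.exhaust by auto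

lemma UNIV_letter: "UNIV = {Reset, Tick, Rotate}"
  using letter.exhaust by auto

lemma finite_counter_states: "finite (states m p)"
  by (simp add: states_def UNIV_symbol UNIV_mode)

lemma card_states: "card (states m p) = 3 * m + 21 + p"
proof -
  let ?A = "(\<lambda>(j, s). Rest j s) ` ({1..m} \<times> UNIV)"
  let ?B = "(\<lambda>(s, k). Head s k) ` (UNIV \<times> {..3})"
  let ?C = "(\<lambda>(c, k). Control c k) ` (UNIV \<times> {..3})"
  have A: "card ?A = 3 * m" "finite ?A"
    by (subst card_image) (auto simp: inj_on_def card_cartesian_product UNIV_symbol)
  have B: "card ?B = 12" "finite ?B"
    by (subst card_image) (auto simp: inj_on_def card_cartesian_product UNIV_symbol)
  have C: "card ?C = 8" "finite ?C"
    by (subst card_image) (auto simp: inj_on_def card_cartesian_product UNIV_mode)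
  have D: "card (Pad ` {..<p}) = p"
    by (subst card_image) (auto simp: inj_on_def)
  have "card (?A \<union> ?B) = 3 * m + 12"
    using A B by (subst card_Un_disjoint) auto
  then have "card (?A \<union> ?B \<union> ?C) = 3 * m + 20"
    using A B C by (subst card_Un_disjoint) auto
  then have "card (?A \<union> ?B \<union> ?C \<union> {Final}) = 3 * m + 21"
    using A B C by (subst card_Un_disjoint) auto
  then show ?thesis
    unfolding states_def using A B C D by (subst card_Un_disjoint) auto
qed

lemma rewrite_le: "rewrite s k \<noteq> None \<Longrightarrow> k \<le> 3"
  by (cases s) (auto split: if_splits)

lemma transition_closed:
  assumes "m \<ge> 1" and "q \<in> states m p" and "transition m q a = Some q'"
  shows "q' \<in> states m p"
proof (cases q)
  case (Rest j s)
  with assms show ?thesis by (cases a) (auto simp: place_def)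
next
  case (Head s k)
  with assms show ?thesis by (cases a) auto
next
  case (Control c k)
  with assms show ?thesis by (cases a; cases c) (auto split: if_splits)
qed (use assms in \<open>cases a; auto\<close>)+

lemma pfa_counter:
  assumes "m \<ge> 1"
  shows "pfa (states m p) UNIV (counter m p)"
proof
  show "finite (UNIV :: letter set)" by (simp add: UNIV_letter)
  show "ran (counter m p) \<subseteq> states m p"
    using transition_closed[OF assms] by (auto simp: ran_def counter_def split: if_splits)
qed (auto simp: finite_counter_states counter_def split: if_splits)

section \<open>Configurations\<close>

text \<open>The list \<open>L\<close> is the ring read from the head position on, and \<open>k\<close> is the number of ticks
  since the last rotation. The list may be shorter than the ring, which describes the cells
  that are left while the ring is being emptied after an overflow.\<close>

definition cells :: "nat \<Rightarrow> symbol list \<Rightarrow> state set" where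
  "cells k L = (\<lambda>i. place i (L ! i) k) ` {..<length L}"

lemma cells_Nil [simp]: "cells k [] = {}"
  by (simp add: cells_def)

lemma cells_Cons: "cells k (s # L) = insert (Head s k) ((\<lambda>i. Rest (Suc i) (L ! i)) ` {..<length L})"
proof -
  have "cells k (s # L) = insert (place 0 s k) ((\<lambda>i. place (Suc i) (L ! i) k) ` {..<length L})"
    by (simp add: cells_def lessThan_Suc_eq_insert_0 image_image)
  then show ?thesis
    by (simp add: place_def)
qed

lemma cells_snoc:
  assumes "length L \<noteq> 0"
  shows "cells k (L @ [s]) = insert (Rest (length L) s) (cells k L)"
  using assms by (auto simp: cells_def lessThan_Suc nth_append place_def)

lemma cells_subset:
  assumes "k \<le> 3" and "length L \<le> Suc m"
  shows "cells k L \<subseteq> states m p"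
  using assms by (auto simp: cells_def place_def)

lemma tick_cells:
  assumes "k < 3" and "length L \<le> Suc m"
  shows "(\<lambda>q. counter m p (q, Tick)) ` cells k L = Some ` cells (Suc k) L"
  using assms unfolding cells_def image_image
  by (intro image_cong) (auto simp: counter_def place_def)

lemma rotate_rest:
  assumes "length L \<le> m"
  shows "(\<lambda>i. counter m p (Rest (Suc i) (L ! i), Rotate)) ` {..<length L} = Some ` cells 0 L"
  using assms unfolding cells_def image_image
  by (intro image_cong) (auto simp: counter_def)

lemma rotate_cells:
  assumes "m \<ge> 1" and "length L = m" and "rewrite s k = Some s'"
  shows "(\<lambda>q. counter m p (q, Rotate)) ` cells k (s # L) = Some ` cells 0 (L @ [s'])"
proof -
  have "k \<le> 3" using assms(3) rewrite_le by force
  moreover have "cells 0 (L @ [s']) = insert (Rest m s') (cells 0 L)"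
    using assms cells_snoc[of L 0 s'] by auto
  moreover have "(\<lambda>i. counter m p (Rest (Suc i) (L ! i), Rotate)) ` {..<m} = Some ` cells 0 L"
    using rotate_rest[of L m p] assms(2) by simp
  ultimately show ?thesis
    using assms by (simp add: cells_Cons image_image) (simp add: counter_def)
qed

definition config :: "mode \<Rightarrow> nat \<Rightarrow> symbol list \<Rightarrow> state set" where
  "config c k L = insert (Control c k) (cells k L)"

text \<open>During a turn of the ring, the bits behind the mark are those already processed. Both
  lists have the less significant bits first, so the number on the ring is \<open>lo @ hi\<close>, while
  the next bit to be processed is the first one of \<open>hi\<close>.\<close>

definition ring :: "bool list \<Rightarrow> bool list \<Rightarrow> symbol list" where
  "ring hi lo = map Bit hi @ Mark # map Bit lo"

lemma length_ring [simp]: "length (ring hi lo) = Suc (length hi + length lo)"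
  by (simp add: ring_def)

lemma ring_Cons: "ring (b # hi) lo = Bit b # ring hi lo"
  and ring_snoc: "ring hi lo @ [Bit b] = ring hi (lo @ [b])"
  and ring_Nil: "ring [] lo = Mark # map Bit lo"
  and ring_mark: "map Bit bs @ [Mark] = ring bs []"
  by (simp_all add: ring_def)

text \<open>\<open>Reset\<close> looks only at positions. In a configuration each position is occupied, so each
  cell of the initial ring is hit, although the token of a given cell may take over the
  part of another one.\<close>

lemma reset_config:
  assumes "k \<le> 3" and "length L = Suc m"
  shows "(\<lambda>q. counter m p (q, Reset)) ` config c k L
    = Some ` config Copy 0 (ring [] (replicate m False))"
proof -
  obtain s M where L: "L = s # M" and M: "length M = m"
    using assms(2) by (cases L) auto
  have "(\<lambda>i. counter m p (Rest (Suc i) (M ! i), Reset)) ` {..<m}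
      = (\<lambda>i. Some (Rest (Suc i) (map Bit (replicate m False) ! i))) ` {..<m}"
    by (intro image_cong) (auto simp: counter_def)
  then show ?thesis
    using assms(1) M
    by (simp add: config_def L ring_Nil cells_Cons image_image) (simp add: counter_def)
qed

lemma reset_states:
  assumes "m \<ge> 1"
  shows "(\<lambda>q. counter m p (q, Reset)) ` states m p
    = Some ` config Copy 0 (ring [] (replicate m False))" (is "?l = ?r")
proof
  let ?C = "config Copy 0 (ring [] (replicate m False))"
  have "?C \<subseteq> states m p"
    by (auto simp: config_def intro!: set_mp[OF cells_subset])
  moreover have "(\<lambda>q. counter m p (q, Reset)) ` ?C = ?r"
    by (rule reset_config) auto
  ultimately show "?r \<subseteq> ?l"
    by (metis image_mono)
  have "counter m p (q, Reset) \<in> ?r" if "q \<in> states m p" for q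
  proof (cases q)
    case (Rest j s)
    then have "1 \<le> j" "j \<le> m"
      using that by auto
    then obtain i where i: "j = Suc i" "i < m"
      by (cases j) auto
    then have "Rest j (Bit False) = Rest (Suc i) (map Bit (replicate m False) ! i)"
      by simp
    then have "Rest j (Bit False) \<in> ?C"
      unfolding config_def ring_Nil cells_Cons using i by auto
    then show ?thesis
      using that Rest by (simp add: counter_def)
  qed (use that in \<open>auto simp: counter_def config_def ring_Nil cells_Cons\<close>)
  then show "?l \<subseteq> ?r" by blast
qed

lemma tick_config:
  assumes "k < (case c of Copy \<Rightarrow> 1 | Carry \<Rightarrow> 3)" and "length L = Suc m"
  shows "(\<lambda>q. counter m p (q, Tick)) ` config c k L = Some ` config c (Suc k) L"
proof -
  have "k < 3" using assms(1) by (cases c) auto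
  then show ?thesis
    using assms by (simp add: config_def tick_cells) (simp add: counter_def)
qed

lemma rotate_config:
  assumes "m \<ge> 1" and "length L = m" and "rewrite s k = Some s'"
    and "next_control c k = Some (Control c' 0)"
  shows "(\<lambda>q. counter m p (q, Rotate)) ` config c k (s # L) = Some ` config c' 0 (L @ [s'])"
proof -
  have "k \<le> 3" using assms(3) rewrite_le by force
  then show ?thesis
    using assms by (simp add: config_def rotate_cells) (simp add: counter_def)
qed

section \<open>No short word synchronizes\<close>

text \<open>The number on the ring, including the pending carry, which is worth as much as
  the next bit to be processed. With this correction the processing of a bit does not change
  the weight; only the start of an increment raises it.\<close>

definition weight :: "mode \<Rightarrow> bool list \<Rightarrow> bool list \<Rightarrow> nat" where
  "weight c hi lo = horner_sum of_bool 2 (lo @ hi) + (if c = Carry then 2 ^ length lo else 0)"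

lemma horner_sum_replicate_False: "horner_sum of_bool (2::nat) (replicate m False) = 0"
  by (induction m) auto

text \<open>This is where the partiality of the automaton does its work: unless the tokens represent
  a number that is already \<open>2 ^ m\<close>, every letter that no token forbids is a correct
  step of the counter. For a rotation, the cell in head position and the control token have
  only one announcement in common, except for a mark in mode \<open>Carry\<close>, where the weight
  contains the full summand \<open>2 ^ m\<close>.\<close>

lemma defined_config_step:
  assumes m: "m \<ge> 1" and len: "length hi + length lo = m" and k: "k \<le> 3"
    and "defined": "\<forall>q \<in> config c k (ring hi lo). counter m p (q, a) \<noteq> None"
  shows "2 ^ m \<le> weight c hi lo \<or>
    (\<exists>c' k' hi' lo'. k' \<le> 3 \<and> length hi' + length lo' = m
      \<and> maps_onto (counter m p) (config c k (ring hi lo)) [a] (config c' k' (ring hi' lo'))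
      \<and> weight c' hi' lo' \<le> Suc (weight c hi lo))"
    (is "?big \<or> (\<exists>c' k' hi' lo'. ?step c' k' hi' lo')")
proof (cases a)
  case Reset
  then have "?step Copy 0 [] (replicate m False)"
    using reset_config[OF k, of "ring hi lo" m p c] len
    by (simp add: maps_onto_letter weight_def horner_sum_replicate_False)
  then show ?thesis by blast
next
  case Tick
  have control: "k < (case c of Copy \<Rightarrow> 1 | Carry \<Rightarrow> 3)"
    using "defined" k Tick by (auto simp: config_def counter_def split: if_splits)
  then have "Suc k \<le> 3" by (cases c) auto
  then have "?step c (Suc k) hi lo"
    using tick_config[OF control, of "ring hi lo" m p] len Tick
    by (simp add: maps_onto_letter)
  then show ?thesis by blast
next
  case Rotate
  obtain s L where L: "ring hi lo = s # L"
    by (cases "ring hi lo") (auto simp: ring_def)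
  then have lenL: "length L = m"
    using len by (metis length_ring length_Cons Suc_inject)
  have "Head s k \<in> config c k (ring hi lo)" "Control c k \<in> config c k (ring hi lo)"
    by (simp_all add: config_def L cells_Cons)
  then have "counter m p (Head s k, Rotate) \<noteq> None" "counter m p (Control c k, Rotate) \<noteq> None"
    using "defined" Rotate by blast+
  then have head: "rewrite s k \<noteq> None" and control: "next_control c k \<noteq> None"
    using k by (simp_all add: counter_def)
  have move: "maps_onto (counter m p) (config c k (ring hi lo)) [a] (config c' 0 (L @ [s']))"
    if "rewrite s k = Some s'" "next_control c k = Some (Control c' 0)" for s' c'
    using rotate_config[OF m lenL that] Rotate by (simp add: maps_onto_letter L)
  show ?thesis
  proof (cases hi)
    case Nil
    then have s: "s = Mark" and L': "L = map Bit lo"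
      using L by (auto simp: ring_Nil)
    then have [simp]: "k = 1"
      using head by (auto split: if_splits)
    show ?thesis
    proof (cases c)
      case Copy
      then have "?step Carry 0 lo []"
        using move[of Mark Carry] len Nil s
        by (simp add: L' ring_mark weight_def)
      then show ?thesis by blast
    next
      case Carry
      then have ?big
        using len Nil by (simp add: weight_def)
      then show ?thesis ..
    qed
  next
    case (Cons b hi')
    then have s: "s = Bit b" and L': "L = ring hi' lo"
      using L by (auto simp: ring_Cons)
    have step: "?step c' 0 hi' (lo @ [b'])"
      if "rewrite s k = Some (Bit b')" "next_control c k = Some (Control c' 0)"
        and "weight c' hi' (lo @ [b']) = weight c hi lo" for b' c'
      using move[OF that(1,2)] that(3) len Cons by (simp add: L' ring_snoc)
    show ?thesis
    proof (cases c)
      case Copy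
      then have "k = 0"
        using head control s by (auto split: if_splits)
      then have "?step Copy 0 hi' (lo @ [b])"
        using Copy s Cons by (intro step) (auto simp: weight_def)
      then show ?thesis by blast
    next
      case Carry
      then consider "k = 2" "b" | "k = 3" "\<not> b"
        using head control s by (auto split: if_splits)
      then show ?thesis
      proof cases
        case 1
        then have "?step Carry 0 hi' (lo @ [False])"
          using Carry s Cons by (intro step) (auto simp: weight_def horner_sum_append)
        then show ?thesis by blast
      next
        case 2
        then have "?step Copy 0 hi' (lo @ [True])"
          using Carry s Cons by (intro step) (auto simp: weight_def horner_sum_append)
        then show ?thesis by blast
      qed
    qed
  qed
qed

lemma defined_word_config:
  assumes m: "m \<ge> 1" and "w \<noteq> []"
    and "\<forall>q \<in> states m p. run (counter m p) q w \<noteq> None" and "length w < 2 ^ m"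
  shows "\<exists>c k hi lo. k \<le> 3 \<and> length hi + length lo = m
      \<and> maps_onto (counter m p) (states m p) w (config c k (ring hi lo))
      \<and> weight c hi lo < length w"
  using assms(2-)
proof (induction w rule: rev_induct)
  case Nil
  then show ?case by simp
next
  case (snoc a w)
  have "defined": "\<forall>q \<in> states m p. run (counter m p) q w \<noteq> None"
    using snoc.prems by (auto simp: run_snoc split: bind_splits)
  show ?case
  proof (cases "w = []")
    case True
    \<comment> \<open>On the full state set these two states exclude \<open>Rotate\<close> and \<open>Tick\<close> as first letter.\<close>
    have "Head (Bit False) 1 \<in> states m p" "Control Copy 1 \<in> states m p"
      by simp_all
    then have "counter m p (Head (Bit False) 1, a) \<noteq> None" "counter m p (Control Copy 1, a) \<noteq> None"
      using snoc.prems(2) True by (auto simp: run_def)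
    then have "a = Reset"
      by (cases a) (auto simp: counter_def)
    then show ?thesis
      using reset_states[OF m, of p] True
      by (intro exI[of _ Copy] exI[of _ 0] exI[of _ "[]"] exI[of _ "replicate m False"])
        (simp add: maps_onto_letter weight_def horner_sum_replicate_False)
  next
    case False
    then obtain c k hi lo where IH: "k \<le> 3" "length hi + length lo = m"
        "maps_onto (counter m p) (states m p) w (config c k (ring hi lo))"
        "weight c hi lo < length w"
      using snoc.IH "defined" snoc.prems(3) by auto
    have "counter m p (q', a) \<noteq> None" if "q' \<in> config c k (ring hi lo)" for q'
    proof -
      have "Some q' \<in> (\<lambda>q. run (counter m p) q w) ` states m p"
        using IH(3) that by (simp add: maps_onto_def)
      then obtain q where "q \<in> states m p" "run (counter m p) q w = Some q'"
        by auto
      then show ?thesis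
        using snoc.prems(2) by (auto simp: run_snoc)
    qed
    from defined_config_step[OF m IH(2,1), of c p a] this obtain c' k' hi' lo' where
      "k' \<le> 3" "length hi' + length lo' = m"
      "maps_onto (counter m p) (config c k (ring hi lo)) [a] (config c' k' (ring hi' lo'))"
      "weight c' hi' lo' \<le> Suc (weight c hi lo)"
      using IH(4) snoc.prems(3) by fastforce
    then show ?thesis
      using maps_onto_append[OF IH(3)] IH(4) by fastforce
  qed
qed

text \<open>Before the weight can reach \<open>2 ^ m\<close>, the head cell and the control token occupy two
  different states.\<close>

lemma synchronizing_word_long:
  assumes m: "m \<ge> 1" and w: "carefully_synchronizing_word (states m p) UNIV (counter m p) w"
  shows "2 ^ m \<le> length w"
proof (rule ccontr)
  assume "\<not> 2 ^ m \<le> length w"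
  obtain q\<^sub>s where qs: "\<forall>q \<in> states m p. run (counter m p) q w = Some q\<^sub>s"
    using w by (auto simp: carefully_synchronizing_word_def)
  have "w \<noteq> []"
  proof
    assume "w = []"
    then have "Final = q\<^sub>s" "Head Mark 0 = q\<^sub>s"
      using qs[rule_format, of Final] qs[rule_format, of "Head Mark 0"] by simp_all
    then show False by auto
  qed
  then obtain c k hi lo where *:
      "maps_onto (counter m p) (states m p) w (config c k (ring hi lo))"
    using defined_word_config[OF m] qs \<open>\<not> 2 ^ m \<le> length w\<close> by fastforce
  have "Some ` config c k (ring hi lo) \<subseteq> {Some q\<^sub>s}"
    using * qs by (auto simp flip: * [unfolded maps_onto_def])
  then have "config c k (ring hi lo) \<subseteq> {q\<^sub>s}"
    by auto
  moreover obtain s L where "ring hi lo = s # L"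
    by (cases "ring hi lo") (auto simp: ring_def)
  then have "{Head s k, Control c k} \<subseteq> config c k (ring hi lo)"
    by (simp add: config_def cells_Cons)
  ultimately show False by auto
qed

section \<open>Some word synchronizes\<close>

lemma ticks_config:
  assumes "i \<le> (case c of Copy \<Rightarrow> 1 | Carry \<Rightarrow> 3)" and "length L = Suc m"
  shows "maps_onto (counter m p) (config c 0 L) (replicate i Tick) (config c i L)"
  using assms(1)
proof (induction i)
  case 0
  then show ?case by (simp add: maps_onto_Nil)
next
  case (Suc i)
  then have "maps_onto (counter m p) (config c i L) [Tick] (config c (Suc i) L)"
    using assms(2) by (intro maps_onto_letter[THEN iffD2] tick_config) auto
  then show ?case
    using Suc maps_onto_append[of _ _ "replicate i Tick" _ "[Tick]"]
    by (simp add: replicate_append_same)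
qed

lemma process_cell:
  assumes "m \<ge> 1" and "length L = m" and "i \<le> (case c of Copy \<Rightarrow> 1 | Carry \<Rightarrow> 3)"
    and "rewrite s i = Some s'" and "next_control c i = Some (Control c' 0)"
  shows "maps_onto (counter m p) (config c 0 (s # L)) (replicate i Tick @ [Rotate])
    (config c' 0 (L @ [s']))"
  using assms by (intro maps_onto_append[OF ticks_config] maps_onto_letter[THEN iffD2] rotate_config)
    auto

text \<open>Once the control token is in \<open>Final\<close>, the word of four ticks and a rotation removes the
  head cell and brings the next one into head position.\<close>

lemma collapse_cells:
  assumes "length L \<le> Suc m"
  shows "\<exists>w. maps_onto (counter m p) (insert Final (cells 0 L)) w {Final}"
  using assms
proof (induction L)
  case Nil
  then show ?case using maps_onto_Nil by auto
next
  case (Cons s L)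
  let ?S = "\<lambda>k. insert Final (cells k (s # L))"
  let ?R = "(\<lambda>i. Rest (Suc i) (L ! i)) ` {..<length L}"
  have tick: "maps_onto (counter m p) (?S k) [Tick] (?S (Suc k))" if "k < 3" for k
    using tick_cells[OF that Cons.prems, of p]
    by (simp add: maps_onto_letter) (simp add: counter_def)
  have "(\<lambda>q. counter m p (q, Tick)) ` ?R = Some ` ?R"
    unfolding image_image using Cons.prems by (intro image_cong) (auto simp: counter_def)
  then have "maps_onto (counter m p) (?S 3) [Tick] (insert Final ?R)"
    by (simp add: maps_onto_letter cells_Cons) (simp add: counter_def)
  moreover have "maps_onto (counter m p) (insert Final ?R) [Rotate] (insert Final (cells 0 L))"
    using Cons.prems rotate_rest[of L m p]
    by (simp add: maps_onto_letter image_image) (simp add: counter_def)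
  moreover obtain w where "maps_onto (counter m p) (insert Final (cells 0 L)) w {Final}"
    using Cons by auto
  moreover have "maps_onto (counter m p) (?S 0) [Tick, Tick, Tick] (?S 3)"
    using maps_onto_append[OF maps_onto_append[OF tick tick] tick, of 0]
    by (simp add: numeral_3_eq_3)
  ultimately show ?case
    by (meson maps_onto_append)
qed

lemma overflow_collapses:
  assumes m: "m \<ge> 1" and "length lo = m"
  shows "\<exists>w. maps_onto (counter m p) (config Carry 0 (ring [] lo)) w {Final}"
proof -
  have "maps_onto (counter m p) (config Carry 0 (ring [] lo)) [Tick] (config Carry 1 (ring [] lo))"
    using ticks_config[of 1 Carry "ring [] lo" m p] assms(2) by simp
  moreover have "maps_onto (counter m p) (config Carry 1 (ring [] lo)) [Rotate]
      (insert Final (cells 0 (ring lo [])))"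
    using rotate_cells[OF m, of "map Bit lo" Mark 1 Mark p] assms(2)
    by (simp add: maps_onto_letter config_def ring_Nil ring_mark) (simp add: counter_def)
  moreover obtain w where "maps_onto (counter m p) (insert Final (cells 0 (ring lo []))) w {Final}"
    using collapse_cells[of "ring lo []" m p] assms(2) by auto
  ultimately show ?thesis
    by (meson maps_onto_append)
qed

text \<open>One round of the counter: processing the cells up to and including the mark either
  overflows or leads to the next larger weight. The induction over the bits still to be
  processed keeps the weight fixed, so it combines with an outer induction over the
  weight.\<close>

lemma increment_collapses:
  assumes m: "m \<ge> 1"
    and next_value: "\<And>c hi lo. length hi + length lo = m \<Longrightarrow> weight c hi lo = Suc W \<Longrightarrow>
      \<exists>w. maps_onto (counter m p) (config c 0 (ring hi lo)) w {Final}"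
  shows "length hi + length lo = m \<Longrightarrow> weight c hi lo = W \<Longrightarrow>
    \<exists>w. maps_onto (counter m p) (config c 0 (ring hi lo)) w {Final}"
proof (induction hi arbitrary: c lo)
  case Nil
  show ?case
  proof (cases c)
    case Copy
    then have "maps_onto (counter m p) (config c 0 (ring [] lo)) (replicate 1 Tick @ [Rotate])
        (config Carry 0 (ring lo []))"
      using process_cell[OF m, of "map Bit lo" 1 c Mark Mark Carry p] Nil(1)
      by (simp add: ring_Nil ring_mark)
    moreover have "weight Carry lo [] = Suc W"
      using Nil(2) Copy by (simp add: weight_def)
    ultimately show ?thesis
      using next_value[of lo "[]" Carry] Nil(1) by (auto intro: maps_onto_append)
  next
    case Carry
    then show ?thesis
      using overflow_collapses[OF m] Nil(1) by simp
  qed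
next
  case (Cons b hi)
  \<comment> \<open>the number of ticks, the new bit and the new mode that a correct increment prescribes\<close>
  define i where "i = (case c of Copy \<Rightarrow> 0 | Carry \<Rightarrow> (if b then 2 else 3 :: nat))"
  define b' where "b' = (case c of Copy \<Rightarrow> b | Carry \<Rightarrow> \<not> b)"
  define c' where "c' = (if b then c else Copy)"
  have "maps_onto (counter m p) (config c 0 (ring (b # hi) lo)) (replicate i Tick @ [Rotate])
      (config c' 0 (ring hi (lo @ [b'])))"
    unfolding ring_Cons ring_snoc[symmetric]
    by (rule process_cell[OF m])
      (use Cons.prems(1) in \<open>auto simp: i_def b'_def c'_def split: mode.splits\<close>)
  moreover have "weight c' hi (lo @ [b']) = W"
    using Cons.prems(2)
    by (cases c) (auto simp: weight_def b'_def c'_def horner_sum_append)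
  ultimately show ?case
    using Cons.IH[of "lo @ [b']" c'] Cons.prems(1) by (auto intro: maps_onto_append)
qed

text \<open>The weight is below \<open>2 ^ Suc m\<close>, as the number is below \<open>2 ^ m\<close> and the
  pending carry is at most \<open>2 ^ m\<close>, so the counter cannot be increased forever and has to overflow.\<close>

lemma config_collapses:
  assumes m: "m \<ge> 1" and "length hi + length lo = m"
  shows "\<exists>w. maps_onto (counter m p) (config c 0 (ring hi lo)) w {Final}"
  using assms(2)
proof (induction "2 ^ Suc m - weight c hi lo" arbitrary: c hi lo rule: less_induct)
  case less
  have "horner_sum of_bool 2 (lo @ hi) < (2::nat) ^ m"
    using horner_sum_bound[of "lo @ hi", where ?'a = nat] less.prems by (simp add: add.commute)
  moreover have "(2::nat) ^ length lo \<le> 2 ^ m"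
    using less.prems by (intro power_increasing) auto
  ultimately have "weight c hi lo < 2 ^ m + 2 ^ m"
    unfolding weight_def by (intro add_less_le_mono) auto
  then have "weight c hi lo < 2 ^ Suc m"
    by simp
  then show ?case
    using less by (intro increment_collapses[OF m _ less.prems refl]) auto
qed

lemma counter_synchronizing:
  assumes m: "m \<ge> 1"
  shows "carefully_synchronizing (states m p) UNIV (counter m p)"
proof -
  obtain w where "maps_onto (counter m p) (config Copy 0 (ring [] (replicate m False))) w {Final}"
    using config_collapses[OF m] by fastforce
  then have "maps_onto (counter m p) (states m p) ([Reset] @ w) {Final}"
    using reset_states[OF m] by (intro maps_onto_append) (auto simp: maps_onto_letter)
  then have "\<forall>q \<in> states m p. run (counter m p) q ([Reset] @ w) = Some Final"
    unfolding maps_onto_def by blast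
  then show ?thesis
    unfolding carefully_synchronizing_def carefully_synchronizing_word_def
    by (intro exI[of _ "[Reset] @ w"]) (auto intro!: bexI[of _ Final])
qed

section \<open>Renaming states and letters\<close>

instance letter :: countable by countable_datatype
instance symbol :: countable by countable_datatype
instance mode :: countable by countable_datatype
instance state :: countable by countable_datatype

text \<open>The restriction to ranges keeps \<open>from_nat\<close> from giving transitions to numbers that
  encode nothing.\<close>

definition renamed ::
  "('q::countable \<times> 'a::countable \<rightharpoonup> 'q) \<Rightarrow> nat \<times> nat \<rightharpoonup> nat" where
  "renamed \<delta> = (\<lambda>(x, y). if x \<in> range (to_nat :: 'q \<Rightarrow> nat) \<and> y \<in> range (to_nat :: 'a \<Rightarrow> nat)
     then map_option to_nat (\<delta> (from_nat x, from_nat y)) else None)"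

lemma renamed_to_nat: "renamed \<delta> (to_nat q, to_nat a) = map_option to_nat (\<delta> (q, a))"
  by (simp add: renamed_def)

lemma run_renamed: "run (renamed \<delta>) (to_nat q) (map to_nat w) = map_option to_nat (run \<delta> q w)"
proof (induction w rule: rev_induct)
  case (snoc a w)
  then show ?case
    by (cases "run \<delta> q w") (simp_all add: run_snoc renamed_to_nat)
qed simp

lemma pfa_renamed:
  fixes \<delta> :: "'q::countable \<times> 'a::countable \<rightharpoonup> 'q"
  assumes "pfa Q \<Sigma> \<delta>"
  shows "pfa (to_nat ` Q) (to_nat ` \<Sigma>) (renamed \<delta>)"
proof -
  interpret pfa Q \<Sigma> \<delta> by fact
  have "x \<in> to_nat ` Q \<and> y \<in> to_nat ` \<Sigma> \<and> z \<in> to_nat ` Q"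
    if "renamed \<delta> (x, y) = Some z" for x y z
  proof -
    have "x \<in> range (to_nat :: 'q \<Rightarrow> nat) \<and> y \<in> range (to_nat :: 'a \<Rightarrow> nat)"
      using that by (simp add: renamed_def split: if_splits)
    then obtain q :: 'q and a :: 'a where qa: "x = to_nat q" "y = to_nat a"
      by blast
    with that obtain q' where "\<delta> (q, a) = Some q'" "z = to_nat q'"
      by (auto simp: renamed_to_nat)
    moreover from this have "q \<in> Q" "a \<in> \<Sigma>" "q' \<in> Q"
      using dom_delta ran_delta by (auto intro: ranI)
    ultimately show ?thesis
      using qa by simp
  qed
  then show ?thesis
    using finite_states finite_alphabet by unfold_locales (auto simp: dom_def ran_def)
qed

lemma carefully_synchronizing_word_renamed:
  "carefully_synchronizing_word (to_nat ` Q) (to_nat ` \<Sigma>) (renamed \<delta>) (map to_nat w)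
    \<longleftrightarrow> carefully_synchronizing_word Q \<Sigma> \<delta> w"
  by (auto simp: carefully_synchronizing_word_def run_renamed in_lists_conv_set)

lemma carefully_synchronizing_word_renamedE:
  fixes \<delta> :: "'q::countable \<times> 'a::countable \<rightharpoonup> 'q"
  assumes "carefully_synchronizing_word (to_nat ` Q) (to_nat ` \<Sigma>) (renamed \<delta>) w"
  obtains v where "w = map to_nat v" and "carefully_synchronizing_word Q \<Sigma> \<delta> v"
proof -
  have "w \<in> lists (to_nat ` \<Sigma>)"
    using assms by (simp add: carefully_synchronizing_word_def)
  then have "w = map to_nat (map (from_nat :: nat \<Rightarrow> 'a) w)"
    by (induction w) auto
  with that assms show thesis
    by (metis carefully_synchronizing_word_renamed)
qed

section \<open>The growth rate\<close>

text \<open>An automaton with \<open>m\<close> bits has \<open>3 * m + 21\<close> states and at most two pads. The additive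
  constant 23 costs a factor below \<open>2 ^ 8\<close>.\<close>

lemma golden_ratio_powr_le:
  assumes "n \<le> 3 * m + 23"
  shows "golden_ratio powr (real n / 3) \<le> 256 * 2 ^ m"
proof -
  have "sqrt 5 < 3"
    by (rule real_less_lsqrt) auto
  then have "golden_ratio powr (real n / 3) \<le> 2 powr (real n / 3)"
    by (intro powr_mono2) (auto simp: golden_ratio_def)
  also have "\<dots> \<le> 2 powr real (m + 8)"
    using assms by (intro powr_mono) auto
  also have "\<dots> = 256 * 2 ^ m"
    by (simp add: powr_add powr_realpow)
  finally show ?thesis .
qed

theorem theorem7:
  shows "\<exists>c::real. c > 0 \<and> (\<exists>N::nat. \<forall>n\<ge>N.
    \<exists>(Q :: nat set) (\<Sigma> :: nat set) (\<delta> :: nat \<times> nat \<rightharpoonup> nat).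
      pfa Q \<Sigma> \<delta> \<and> card Q = n \<and> card \<Sigma> = 3 \<and>
      carefully_synchronizing Q \<Sigma> \<delta> \<and>
      (\<forall>w. carefully_synchronizing_word Q \<Sigma> \<delta> w \<longrightarrow>
        real (length w) \<ge> c * golden_ratio powr (real n / 3)))"
proof (intro exI[of _ "1 / 256"] conjI exI[of _ 24] allI impI)
  fix n :: nat
  assume n: "n \<ge> 24"
  define m where "m = (n - 21) div 3"
  define p where "p = (n - 21) mod 3"
  have m: "m \<ge> 1" and size: "n = 3 * m + 21 + p" and p: "p \<le> 2"
    using n by (auto simp: m_def p_def)
  let ?Q = "to_nat ` states m p" and ?\<Sigma> = "range (to_nat :: letter \<Rightarrow> nat)"
    and ?\<delta> = "renamed (counter m p)"
  have "pfa ?Q ?\<Sigma> ?\<delta>"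
    using pfa_renamed[OF pfa_counter[OF m]] .
  moreover have "card ?Q = n"
    by (simp add: card_image card_states size)
  moreover have "card ?\<Sigma> = 3"
    by (simp add: card_image) (simp add: UNIV_letter)
  moreover have "carefully_synchronizing ?Q ?\<Sigma> ?\<delta>"
    using counter_synchronizing[OF m] carefully_synchronizing_word_renamed
    unfolding carefully_synchronizing_def by blast
  moreover have "1 / 256 * golden_ratio powr (real n / 3) \<le> real (length w)"
    if sync: "carefully_synchronizing_word ?Q ?\<Sigma> ?\<delta> w" for w
  proof -
    obtain v where "w = map to_nat v"
        and "carefully_synchronizing_word (states m p) UNIV (counter m p) v"
      using carefully_synchronizing_word_renamedE[OF sync] by blast
    then have "2 ^ m \<le> length w"
      using synchronizing_word_long[OF m] by simp
    then have "2 ^ m \<le> real (length w)"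
      by (metis of_nat_le_iff of_nat_numeral of_nat_power)
    moreover have "golden_ratio powr (real n / 3) \<le> 256 * 2 ^ m"
      using size p by (intro golden_ratio_powr_le) simp
    ultimately show ?thesis
      by linarith
  qed
  ultimately show "\<exists>(Q :: nat set) (\<Sigma> :: nat set) (\<delta> :: nat \<times> nat \<rightharpoonup> nat).
      pfa Q \<Sigma> \<delta> \<and> card Q = n \<and> card \<Sigma> = 3 \<and>
      carefully_synchronizing Q \<Sigma> \<delta> \<and>
      (\<forall>w. carefully_synchronizing_word Q \<Sigma> \<delta> w \<longrightarrow>
        real (length w) \<ge> 1 / 256 * golden_ratio powr (real n / 3))"
    by blast
qed simp

end
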